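(* Let $n$ be a squarefree odd positive integer. Then $$\varrho(n)=\prod_{p\mid n}\frac{p-1}{2}=\bigl|\mathrm{QR}^{*}(\mathbb{Z}/n\mathbb{Z})\bigr|,$$ where the product runs over the primes $p$ dividing $n$.
   Context: $\varphi$ is Euler's totient function, $\omega(n)$ is the number of distinct prime divisors of $n$, and $\varrho(n):=\varphi(n)/2^{\omega(n)}$. The set $\mathrm{QR}^{*}(\mathbb{Z}/n\mathbb{Z})$ is $\{x\in(\mathbb{Z}/n\mathbb{Z})^*: x\equiv y^2\pmod n\text{ for some }y\}$, i.e. the set of squares in $(\mathbb{Z}/n\mathbb{Z})^*$. *)

theory Defs
  imports "HOL-Number_Theory.Number_Theory" "HOL-Computational_Algebra.Squarefree"
begin

definition omega :: "nat \<Rightarrow> nat" where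
  "omega n = card (prime_factors n)"

text \<open>Values are taken in \<^typ>\<open>real\<close>, since for even \<open>n\<close> the quotient need not be an integer.\<close>

definition varrho :: "nat \<Rightarrow> real" where
  "varrho n = real (totient n) / 2 ^ omega n"

text \<open>
  Elements of \<open>\<int>/n\<int>\<close> are represented by the least residues \<open>0, \<dots>, n - 1\<close>. We do not use
  \<^term>\<open>Units (residue_ring (int n))\<close> as the definition, because \<^const>\<open>residue_ring\<close> is
  degenerate for modulus 1: its carrier is \<open>{0}\<close> but its unit element is the integer 1, so that
  it has no units, whereas the unit group of the zero ring has one element. For all larger moduli
  the two agree, as shown below.
\<close>

definition unit_residues :: "nat \<Rightarrow> int set" where
  "unit_residues n = {x \<in> {0..<int n}. \<exists>z. [x * z = 1] (mod int n)}"

lemma unit_residues_eq_Units: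
  assumes "n > 1"
  shows "unit_residues n = Units (residue_ring (int n))"
proof (intro Set.equalityI subsetI)
  fix x assume "x \<in> unit_residues n"
  then obtain z where x: "0 \<le> x" "x < int n" and z: "[x * z = 1] (mod int n)"
    by (auto simp: unit_residues_def)
  have "x * (z mod int n) mod int n = 1"
    using z assms by (simp add: cong_def mod_mult_right_eq)
  moreover have "z mod int n \<in> {0..int n - 1}"
    using assms by simp
  ultimately show "x \<in> Units (residue_ring (int n))"
    using x by (auto simp: Units_def residue_ring_def mult.commute)
next
  fix x assume "x \<in> Units (residue_ring (int n))"
  then show "x \<in> unit_residues n"
    using assms by (auto simp: unit_residues_def Units_def residue_ring_def cong_def)
qed

definition QR_star :: "nat \<Rightarrow> int set" where
  "QR_star n = {x \<in> unit_residues n. QuadRes (int n) x}"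

end

theory Submission
  imports Defs
begin

text \<open>
  Both equalities reduce to primes, because each quantity is multiplicative over coprime factors
  and a squarefree number is the product of its distinct prime factors.

  For \<open>\<phi>\<close> this is classical, and dividing each factor \<open>\<phi>(p) = p - 1\<close> by \<open>2\<close> uses up the power
  \<open>2^\<omega>(n)\<close> exactly. For the number of unit squares, the Chinese remainder theorem splits
  \<open>QR*(\<int>/ab\<int>)\<close> as \<open>QR*(\<int>/a\<int>) \<times> QR*(\<int>/b\<int>)\<close> (\<open>card_QR_star_mult\<close>): a pair of square roots modulo
  \<open>a\<close> and \<open>b\<close> glues to a square root modulo \<open>ab\<close>. Modulo an odd prime \<open>p\<close> the squaring map on
  units identifies exactly \<open>y\<close> and \<open>-y\<close>, so half of the \<open>p - 1\<close> units are squares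
  (\<open>card_QR_star_prime\<close>).
\<close>

text \<open>
  For integers, invertibility modulo \<open>n\<close> is coprimality, which behaves well under taking products
  of moduli and under congruence.
\<close>
lemma QR_star_iff:
  "x \<in> QR_star n \<longleftrightarrow>
     0 \<le> x \<and> x < int n \<and> coprime x (int n) \<and> (\<exists>y. [y\<^sup>2 = x] (mod int n))"
  by (auto simp: QR_star_def unit_residues_def QuadRes_def coprime_iff_invertible_int)

lemma finite_QR_star [simp]: "finite (QR_star n)"
  by (rule finite_subset[of _ "{0..<int n}"]) (auto simp: QR_star_iff)

lemma mod_in_QR_star:
  assumes "x \<in> QR_star n" "d dvd n" "d > 0"
  shows "x mod int d \<in> QR_star d"
proof -
  from assms obtain y where cop: "coprime x (int n)" and y: "[y\<^sup>2 = x] (mod int n)"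
    by (auto simp: QR_star_iff)
  have dvd: "int d dvd int n" using assms by simp
  have "coprime x (int d)"
    using coprime_divisors[OF dvd_refl dvd cop] .
  moreover have "[y\<^sup>2 = x mod int d] (mod int d)"
    using cong_dvd_modulus[OF y dvd] by (simp add: cong_def)
  ultimately show ?thesis
    using assms by (auto simp: QR_star_iff)
qed

lemma card_QR_star_mult:
  assumes "coprime a b" "a > 0" "b > 0"
  shows "card (QR_star (a * b)) = card (QR_star a) * card (QR_star b)"
proof -
  let ?f = "\<lambda>x. (x mod int a, x mod int b)"
  have cop: "coprime (int a) (int b)" using assms by simp
  have inj: "inj_on ?f (QR_star (a * b))"
  proof (rule inj_onI)
    fix x y assume xy: "x \<in> QR_star (a * b)" "y \<in> QR_star (a * b)" "?f x = ?f y"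
    then have "[x = y] (mod int a * int b)"
      using cop by (intro coprime_cong_mult) (auto simp: cong_def)
    with xy show "x = y"
      by (auto simp: QR_star_iff cong_def)
  qed
  have "?f ` QR_star (a * b) = QR_star a \<times> QR_star b"
  proof (intro Set.equalityI subsetI)
    fix z assume "z \<in> ?f ` QR_star (a * b)"
    then show "z \<in> QR_star a \<times> QR_star b"
      using assms by (auto intro: mod_in_QR_star)
  next
    fix z assume "z \<in> QR_star a \<times> QR_star b"
    then obtain u v where z: "z = (u, v)" and u: "u \<in> QR_star a" and v: "v \<in> QR_star b"
      by auto
    from u v obtain r s where r: "[r\<^sup>2 = u] (mod int a)" and s: "[s\<^sup>2 = v] (mod int b)"
      by (auto simp: QR_star_iff)
    obtain y where y: "[y = r] (mod int a)" "[y = s] (mod int b)"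
      using binary_chinese_remainder_int[OF cop] by blast
    \<comment> \<open>Gluing the roots rather than the residues makes the preimage a square by construction.\<close>
    define x where "x = y\<^sup>2 mod (int a * int b)"
    have xa: "[x = u] (mod int a)" and xb: "[x = v] (mod int b)"
      using cong_trans[OF cong_pow[OF y(1)] r] cong_trans[OF cong_pow[OF y(2)] s]
      by (simp_all add: x_def cong_def mod_mod_cancel)
    have "coprime x (int a)" "coprime x (int b)"
      using cong_imp_coprime[OF cong_sym[OF xa]] cong_imp_coprime[OF cong_sym[OF xb]] u v
      by (auto simp: QR_star_iff)
    then have "x \<in> QR_star (a * b)"
      using assms by (auto simp: QR_star_iff x_def cong_def intro!: exI[of _ y])
    moreover have "?f x = z"
      using xa xb u v by (simp add: z cong_def QR_star_iff)
    ultimately show "z \<in> ?f ` QR_star (a * b)"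
      by blast
  qed
  then show ?thesis
    using card_image[OF inj] by (simp add: card_cartesian_product)
qed

text \<open>
  The residues \<open>1, \<dots>, (p - 1) / 2\<close> contain exactly one of \<open>y\<close> and \<open>-y\<close> for each unit \<open>y\<close>, and
  these two are the only roots of \<open>y\<^sup>2\<close> modulo a prime; so squaring maps these residues bijectively
  onto the unit squares.
\<close>
lemma card_QR_star_prime:
  assumes p: "prime p" and "odd p"
  shows "card (QR_star p) = (p - 1) div 2"
proof -
  let ?H = "{1..(int p - 1) div 2}"
  let ?sq = "\<lambda>y. y\<^sup>2 mod int p"
  have p': "prime (int p)" using p by simp
  have odd: "odd (int p)" using assms by simp
  have inj: "inj_on ?sq ?H"
  proof (rule inj_onI)
    fix x y assume x: "x \<in> ?H" and y: "y \<in> ?H" and "?sq x = ?sq y"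
    then have "int p dvd x\<^sup>2 - y\<^sup>2"
      by (simp add: mod_eq_dvd_iff)
    then have "int p dvd (x + y) * (x - y)"
      by (simp add: power2_eq_square algebra_simps)
    then have "int p dvd x + y \<or> int p dvd x - y"
      using p' by (simp add: prime_dvd_mult_iff)
    \<comment> \<open>Both \<open>x + y\<close> and \<open>\<bar>x - y\<bar>\<close> are less than \<open>p\<close>, and \<open>x + y\<close> is positive.\<close>
    moreover have "\<not> int p dvd x + y"
    proof (rule zdvd_not_zless)
      show "0 < x + y" using x y by simp
      show "x + y < int p" using x y by auto
    qed
    moreover have "x - y = 0" if "int p dvd x - y"
      using x y dvd_imp_le_int[OF _ that] by (cases "x - y = 0") auto
    ultimately show "x = y" by auto
  qed
  have "?sq ` ?H = QR_star p"
  proof (intro Set.equalityI subsetI)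
    fix x assume "x \<in> ?sq ` ?H"
    then obtain y where y: "y \<in> ?H" and x: "x = ?sq y" by blast
    have "\<not> int p dvd y"
    proof (rule zdvd_not_zless)
      show "0 < y" using y by simp
      show "y < int p" using y by auto
    qed
    then have "coprime (y\<^sup>2) (int p)"
      using prime_imp_coprime[OF p'] by (simp add: coprime_commute)
    then show "x \<in> QR_star p"
      using prime_gt_0_nat[OF p] by (auto simp: QR_star_iff x cong_def intro!: exI[of _ y])
  next
    fix x assume "x \<in> QR_star p"
    then obtain y where x: "0 \<le> x" "x < int p" "coprime x (int p)" and y: "[y\<^sup>2 = x] (mod int p)"
      by (auto simp: QR_star_iff)
    have xy: "x = y\<^sup>2 mod int p"
      using x y by (simp add: cong_def)
    define r where "r = y mod int p"
    have r: "0 \<le> r" "r < int p"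
      using prime_gt_0_nat[OF p] by (simp_all add: r_def)
    have xr: "x = ?sq r"
      by (simp add: xy r_def power_mod)
    have "r \<noteq> 0"
    proof
      assume "r = 0"
      then have "x = 0" using xr by simp
      then show False using x(3) prime_gt_1_nat[OF p] by simp
    qed
    show "x \<in> ?sq ` ?H"
    proof (cases "r \<le> (int p - 1) div 2")
      case True
      then show ?thesis using r \<open>r \<noteq> 0\<close> xr by auto
    next
      case False
      have "int p - r \<in> ?H"
        using False r odd by (auto elim!: oddE)
      moreover have "x = ?sq (int p - r)"
      proof -
        have "(int p - r)\<^sup>2 = r\<^sup>2 + int p * (int p - 2 * r)"
          by (simp add: power2_eq_square algebra_simps)
        then show ?thesis using xr by simp
      qed
      ultimately show ?thesis by blast
    qed
  qed
  then have "card (QR_star p) = card ?H"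
    using card_image[OF inj] by simp
  also have "\<dots> = (p - 1) div 2"
    using prime_gt_0_nat[OF p] by (simp add: nat_div_distrib nat_diff_distrib)
  finally show ?thesis .
qed

text \<open>The induction runs over finite sets of primes, so that the coprimality needed to split off one
  factor comes for free from distinctness.\<close>
lemma card_QR_star_prod_primes:
  assumes "finite A" "\<And>p. p \<in> A \<Longrightarrow> prime p \<and> odd p"
  shows "card (QR_star (\<Prod>A)) = (\<Prod>p\<in>A. (p - 1) div 2)"
  using assms
proof (induction A rule: finite_induct)
  case empty
  have "QR_star 1 = {0}"
    by (auto simp: QR_star_iff)
  then show ?case by simp
next
  case (insert p A)
  have "coprime p (\<Prod>A)"
    using insert by (intro prod_coprime_right) (metis insert_iff primes_coprime)
  moreover have "\<Prod>A > 0"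
    using insert.prems by (intro prod_pos) (auto intro: prime_gt_0_nat)
  moreover have "p > 0"
    using insert.prems by (auto intro: prime_gt_0_nat)
  ultimately have "card (QR_star (p * \<Prod>A)) = card (QR_star p) * card (QR_star (\<Prod>A))"
    by (intro card_QR_star_mult)
  then show ?case
    using insert by (simp add: card_QR_star_prime)
qed

lemma totient_prod_primes:
  assumes "finite A" "\<And>p. p \<in> A \<Longrightarrow> prime (p :: nat)"
  shows "totient (\<Prod>A) = (\<Prod>p\<in>A. p - 1)"
proof -
  have "totient (\<Prod>A) = (\<Prod>p\<in>A. totient p)"
    using assms totient_prod_coprime[of "\<lambda>p. p" A]
    by (simp add: pairwise_def primes_coprime)
  then show ?thesis
    using assms by (simp add: totient_prime)
qed

theorem corollary4p3:
  fixes n :: nat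
  assumes "n > 0" and "odd n" and "squarefree n"
  shows "varrho n = (\<Prod>p\<in>prime_factors n. (real p - 1) / 2) \<and>
         (\<Prod>p\<in>prime_factors n. (real p - 1) / 2) = real (card (QR_star n))"
proof
  have "multiplicity p n = 1" if "p \<in> prime_factors n" for p
    using that assms by (simp add: squarefree_factorial_semiring')
  then have n: "\<Prod>(prime_factors n) = n"
    using prime_factorization_nat[OF assms(1)] by simp
  have primes: "prime p \<and> odd p" if "p \<in> prime_factors n" for p
    using that assms(2) by (auto simp: in_prime_factors_iff dest: dvd_trans)
  have "real (totient n) = (\<Prod>p\<in>prime_factors n. real (p - 1))"
    using totient_prod_primes[of "prime_factors n"] primes n by simp
  also have "\<dots> = (\<Prod>p\<in>prime_factors n. real p - 1)"
    using primes prime_ge_1_nat by (intro prod.cong refl) (metis of_nat_1 of_nat_diff)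
  finally show "varrho n = (\<Prod>p\<in>prime_factors n. (real p - 1) / 2)"
    by (simp add: varrho_def omega_def prod_dividef)
  have "card (QR_star n) = (\<Prod>p\<in>prime_factors n. (p - 1) div 2)"
    using card_QR_star_prod_primes[of "prime_factors n"] primes n by simp
  then have "real (card (QR_star n)) = (\<Prod>p\<in>prime_factors n. real ((p - 1) div 2))"
    by simp
  also have "\<dots> = (\<Prod>p\<in>prime_factors n. (real p - 1) / 2)"
  proof (intro prod.cong refl)
    fix p assume "p \<in> prime_factors n"
    then obtain k where "p = 2 * k + 1"
      using primes by (blast elim: oddE)
    then show "real ((p - 1) div 2) = (real p - 1) / 2" by simp
  qed
  finally show "(\<Prod>p\<in>prime_factors n. (real p - 1) / 2) = real (card (QR_star n))" ..
qed

end
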